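(* Let $0 < s < t \leq 1$. Then there exist a uniformly discrete unbounded set $X \subseteq \mathbb{R}^2$ and non-empty disjoint open sets $I_s$ and $I_t$ in $G(2,1)$ such that (1) $\dim_{\mathrm{qA}} P_V X = s$ for all $V \in I_s$, (2) $\dim_{\mathrm{qA}} P_V X = t$ for all $V \in I_t$.
   Context: A set $X \subseteq \mathbb{R}^d$ is uniformly discrete if there exists $\delta>0$ such that $|x-y| \geq \delta$ for all distinct $x,y \in X$. $G(2,1)$ is the Grassmannian of $1$-dimensional linear subspaces $V \subseteq \mathbb{R}^2$ with its usual topology (induced by the acute angle between lines). $P_V \colon \mathbb{R}^2 \to V$ is orthogonal projection onto $V$, and $V$ is identified with $\mathbb{R}$. $B(x,R)$ is the closed ball with centre $x$ and radius $R$. $N_r(A)$ is the smallest number of closed balls of radius $r>0$ needed to cover the bounded set $A$. Assouad spectrum: for $X \subseteq \mathbb{R}^m$ and $\theta \in (0,1)$, $\dim_{\mathrm{A}}^\theta X$ is the infimum of all $\alpha \geq 0$ for which there exists a constant $C>0$ such that $N_{R^{1/\theta}}(X \cap B(x,R)) \leq C (R/R^{1/\theta})^\alpha$ for all $0<R<1$ and all $x \in X$. The quasi-Assouad dimension is $\dim_{\mathrm{qA}} X = \lim_{\theta \uparrow 1} \dim_{\mathrm{A}}^\theta X$ (this limit is known to exist). *)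

theory Defs
  imports "HOL-Analysis.Analysis"
begin

definition covering_number :: "real \<Rightarrow> 'a::metric_space set \<Rightarrow> nat" where
  "covering_number r A = (LEAST n. \<exists>C. finite C \<and> card C = n \<and> A \<subseteq> (\<Union>c\<in>C. cball c r))"

definition assouad_spectrum :: "real \<Rightarrow> 'a::euclidean_space set \<Rightarrow> real" where
  "assouad_spectrum \<theta> X = Inf {\<alpha>. 0 \<le> \<alpha> \<and>
     (\<exists>C>0. \<forall>R. 0 < R \<and> R < 1 \<longrightarrow> (\<forall>x\<in>X.
        real (covering_number (R powr (1 / \<theta>)) (X \<inter> cball x R))
          \<le> C * (R / R powr (1 / \<theta>)) powr \<alpha>))}"

definition quasi_assouad_dim :: "'a::euclidean_space set \<Rightarrow> real" where
  "quasi_assouad_dim X = Lim (at_left 1) (\<lambda>\<theta>. assouad_spectrum \<theta> X)"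

definition Gr21 :: "(real^2) set set" where
  "Gr21 = {V. subspace V \<and> dim V = 1}"

definition line_dir :: "(real^2) set \<Rightarrow> real^2" where
  "line_dir V = (SOME e. e \<in> V \<and> norm e = 1)"

text \<open>The norms in the denominator are 1 for lines. They are kept so that the angle is
  nonnegative for all arguments, as \<^locale>\<open>Metric_space\<close> requires.\<close>

definition line_angle :: "(real^2) set \<Rightarrow> (real^2) set \<Rightarrow> real" where
  "line_angle V W = arccos (\<bar>line_dir V \<bullet> line_dir W\<bar> / (norm (line_dir V) * norm (line_dir W)))"

definition Gr21_topology :: "(real^2) set topology" where
  "Gr21_topology = Metric_space.mtopology Gr21 line_angle"

definition orth_proj :: "(real^2) set \<Rightarrow> real^2 \<Rightarrow> real^2" where
  "orth_proj V x = (THE y. y \<in> V \<and> (\<forall>v\<in>V. orthogonal (x - y) v))"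

text \<open>The isometric identification of a line \<open>V\<close> with the reals, unique up to sign.\<close>

definition line_coord :: "(real^2) set \<Rightarrow> real^2 \<Rightarrow> real" where
  "line_coord V y = y \<bullet> line_dir V"

definition proj_on_line :: "(real^2) set \<Rightarrow> (real^2) set \<Rightarrow> real set" where
  "proj_on_line V X = line_coord V ` orth_proj V ` X"

lemma line_dir:
  assumes "V \<in> Gr21"
  shows "line_dir V \<in> V" "norm (line_dir V) = 1" "V = span {line_dir V}"
proof -
  from assms have V: "subspace V" "dim V = 1" by (auto simp: Gr21_def)
  then obtain u where u: "u \<in> V" "u \<noteq> 0"
    by (metis dim_eq_0 singletonI subsetI zero_neq_one)
  then have "\<exists>e. e \<in> V \<and> norm e = 1"
    using V by (intro exI[of _ "u /\<^sub>R norm u"]) (auto simp: subspace_scale)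
  then have *: "line_dir V \<in> V \<and> norm (line_dir V) = 1"
    unfolding line_dir_def by (rule someI_ex)
  then show "line_dir V \<in> V" "norm (line_dir V) = 1" by auto
  have "dim (span {line_dir V}) = 1"
    using * by (subst dim_span) (auto simp: dim_singleton)
  moreover have "span {line_dir V} \<subseteq> V" using * V by (simp add: span_minimal)
  ultimately show "V = span {line_dir V}"
    using V by (metis subspace_dim_equal subspace_span order_refl)
qed

lemma span_singleton_line:
  assumes "V \<in> Gr21"
  shows "V = {k *\<^sub>R line_dir V |k. True}"
  using line_dir(3)[OF assms] unfolding span_singleton by blast

lemma line_angle_eq:
  assumes "V \<in> Gr21" "W \<in> Gr21" "u \<in> V" "w \<in> W" "norm u = 1" "norm w = 1"
  shows "line_angle V W = arccos \<bar>u \<bullet> w\<bar>"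
proof -
  obtain a where a: "u = a *\<^sub>R line_dir V"
    using assms(3) span_singleton_line[OF assms(1)] by blast
  obtain b where b: "w = b *\<^sub>R line_dir W"
    using assms(4) span_singleton_line[OF assms(2)] by blast
  have "\<bar>a\<bar> = 1" "\<bar>b\<bar> = 1"
    using a b assms(5,6) line_dir(2)[OF assms(1)] line_dir(2)[OF assms(2)] by auto
  then show ?thesis
    using line_dir(2)[OF assms(1)] line_dir(2)[OF assms(2)]
    by (simp add: line_angle_def a b abs_mult)
qed

lemma arccos_abs_inner_triangle:
  fixes u v w :: "'a::real_inner"
  assumes "norm u = 1" "norm v = 1" "norm w = 1"
  shows "arccos \<bar>u \<bullet> w\<bar> \<le> arccos \<bar>u \<bullet> v\<bar> + arccos \<bar>v \<bullet> w\<bar>"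
proof -
  have le1: "\<bar>x \<bullet> y\<bar> \<le> 1" if "norm x = 1" "norm y = 1" for x y :: 'a
    using Cauchy_Schwarz_ineq2[of x y] that by simp
  have vv: "v \<bullet> v = 1" "u \<bullet> u = 1" "w \<bullet> w = 1" using assms by (auto simp: norm_eq_1)
  define u' where "u' = u - (u \<bullet> v) *\<^sub>R v"
  define w' where "w' = w - (v \<bullet> w) *\<^sub>R v"
  define a where "a = arccos \<bar>u \<bullet> v\<bar>"
  define b where "b = arccos \<bar>v \<bullet> w\<bar>"
  have nu: "norm u' = sin a"
    using le1[OF assms(1,2)] vv
    by (simp add: a_def sin_arccos_abs u'_def norm_eq_sqrt_inner inner_diff inner_commute power2_eq_square)
  have nw: "norm w' = sin b"
    using le1[OF assms(2,3)] vv
    by (simp add: b_def sin_arccos_abs w'_def norm_eq_sqrt_inner inner_diff inner_commute power2_eq_square)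
  have eq: "u \<bullet> w = (u \<bullet> v) * (v \<bullet> w) + u' \<bullet> w'"
    using vv by (simp add: u'_def w'_def inner_diff inner_commute algebra_simps)
  have "\<bar>u' \<bullet> w'\<bar> \<le> sin a * sin b"
    using Cauchy_Schwarz_ineq2[of u' w'] nu nw by simp
  then have "\<bar>u \<bullet> w\<bar> \<ge> \<bar>u \<bullet> v\<bar> * \<bar>v \<bullet> w\<bar> - sin a * sin b"
    using eq by (simp flip: abs_mult)
  also have "\<bar>u \<bullet> v\<bar> * \<bar>v \<bullet> w\<bar> - sin a * sin b = cos (a + b)"
    using le1[OF assms(1,2)] le1[OF assms(2,3)] by (simp add: cos_add a_def b_def cos_arccos_abs)
  finally have "cos (a + b) \<le> \<bar>u \<bullet> w\<bar>" .
  then have "arccos \<bar>u \<bullet> w\<bar> \<le> arccos (cos (a + b))"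
    using le1[OF assms(1,3)] by (intro arccos_le_arccos) auto
  moreover have "0 \<le> a" "a \<le> pi / 2" "0 \<le> b" "b \<le> pi / 2"
    using le1[OF assms(1,2)] le1[OF assms(2,3)]
    by (simp_all add: a_def b_def arccos_lbound arccos_le_pi2 del: le_divide_eq_numeral1)
  ultimately show ?thesis by (simp add: arccos_cos a_def b_def)
qed

lemma Metric_space_Gr21: "Metric_space Gr21 line_angle"
proof
  fix V W :: "(real^2) set"
  show "0 \<le> line_angle V W"
  proof -
    define q
      where "q = \<bar>line_dir V \<bullet> line_dir W\<bar> / (norm (line_dir V) * norm (line_dir W))"
    have "0 \<le> q" "q \<le> 1"
      using Cauchy_Schwarz_ineq2[of "line_dir V" "line_dir W"]
      unfolding q_def by (auto simp: divide_le_eq_1 zero_less_mult_iff)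
    then show ?thesis by (simp add: line_angle_def arccos_lbound flip: q_def)
  qed
  show "line_angle V W = line_angle W V"
    by (simp add: line_angle_def inner_commute mult.commute)
next
  fix V W assume VW: "V \<in> Gr21" "W \<in> Gr21"
  define e f where "e = line_dir V" and "f = line_dir W"
  have ef: "norm e = 1" "norm f = 1" "V = span {e}" "W = span {f}"
    unfolding e_def f_def by (rule line_dir[OF VW(1)] line_dir[OF VW(2)])+
  have eq: "line_angle V W = arccos \<bar>e \<bullet> f\<bar>"
    using ef(1,2) by (simp add: line_angle_def flip: e_def f_def)
  have "\<bar>e \<bullet> f\<bar> \<le> 1" using Cauchy_Schwarz_ineq2[of e f] ef(1,2) by simp
  then have "line_angle V W = 0 \<longleftrightarrow> \<bar>e \<bullet> f\<bar> = 1"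
    using eq by (simp add: arccos_eq_0_iff)
  also have "\<dots> \<longleftrightarrow> V = W"
  proof
    assume "\<bar>e \<bullet> f\<bar> = 1"
    then have "\<bar>e \<bullet> f\<bar> = norm e * norm f" using ef(1,2) by simp
    then have "e = f \<or> e = - f"
      unfolding norm_cauchy_schwarz_abs_eq using ef(1,2) by auto
    moreover have sub: "span {- x} \<subseteq> span {x}" for x :: "real^2"
      by (intro span_minimal) (auto intro: span_neg span_base)
    ultimately have "span {e} = span {f}"
      using sub[of f] sub[of "- f"] by auto
    then show "V = W" using ef(3,4) by blast
  next
    assume "V = W"
    then have "f = e" by (simp add: e_def f_def)
    then show "\<bar>e \<bullet> f\<bar> = 1" using ef(1) by (simp add: dot_square_norm)
  qed
  finally show "line_angle V W = 0 \<longleftrightarrow> V = W" .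
next
  fix U V W assume "U \<in> Gr21" "V \<in> Gr21" "W \<in> Gr21"
  then show "line_angle U W \<le> line_angle U V + line_angle V W"
    by (simp add: line_angle_def line_dir(2) arccos_abs_inner_triangle)
qed

lemma orth_proj_eq:
  assumes "V \<in> Gr21"
  shows "orth_proj V x = (x \<bullet> line_dir V) *\<^sub>R line_dir V"
  unfolding orth_proj_def
proof (rule the_equality)
  define e where "e = line_dir V"
  have e: "e \<bullet> e = 1" "V = span {e}"
    using line_dir[OF assms] by (auto simp: e_def norm_eq_1)
  show "(x \<bullet> line_dir V) *\<^sub>R line_dir V \<in> V \<and>
      (\<forall>v\<in>V. orthogonal (x - (x \<bullet> line_dir V) *\<^sub>R line_dir V) v)"
    unfolding e_def[symmetric] using e(1)
    by (auto simp: e(2) span_singleton orthogonal_def inner_diff)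
  fix y assume y: "y \<in> V \<and> (\<forall>v\<in>V. orthogonal (x - y) v)"
  then obtain k where k: "y = k *\<^sub>R e" by (auto simp: e(2) span_singleton)
  have "(x - y) \<bullet> e = 0" using y e(2) by (auto simp: orthogonal_def span_base)
  then show "y = (x \<bullet> line_dir V) *\<^sub>R line_dir V"
    using e(1) by (simp add: k inner_diff flip: e_def)
qed

end

theory Submission
  imports Defs
begin

text \<open>
  Write the points of an \<open>s\<close>-dimensional self-similar set as digit sums \<open>c i\<close>, where \<open>i\<close> is any
  natural number and its binary digits are the digits of the point. Spreading these points
  along the direction orthogonal to a line, at heights \<open>4 ^ i\<close>, gives a uniformly discrete set whose
  projection onto that line is the self-similar set. Onto a line of slope \<open>\<tau>\<close> relative to the first one
  it projects to the points \<open>c i + \<tau> * 4 ^ i\<close>, which are still at most \<open>s\<close>-dimensional: for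
  \<open>\<bar>\<tau>\<bar> * 4 ^ i \<le> r / 2\<close> the shift is invisible at scale \<open>r\<close>, for \<open>\<bar>\<tau>\<bar> * 4 ^ i > 4\<close> the points are isolated,
  and the logarithmically many indices in between are negligible when \<open>r = R powr (1 / \<theta>)\<close>.

  Finite pieces of this kind, with larger and larger index ranges and slopes dense in an
  interval, give the dimension \<open>s\<close> for all lines near the first axis. Pieces of the same kind
  for \<open>t\<close> and the second axis project to isolated points on the lines near the first axis, and vice
  versa. All the pieces are placed on the diagonal so far apart that their projections onto any of these
  lines do not interact.
\<close>

section \<open>Covering numbers, separated sets and counting of indices\<close>

lemma covering_number_le:
  assumes "finite C" "A \<subseteq> (\<Union>c\<in>C. cball c r)"
  shows "covering_number r A \<le> card C"
  unfolding covering_number_def using assms by (intro Least_le) auto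

text \<open>A ball of radius \<open>r\<close> holds at most one point of \<open>P\<close>, so
  sending each point to the centre of a ball that covers it is injective. Boundedness of
  \<open>A\<close> gives a finite cover, so that the \<open>LEAST\<close> is attained.\<close>

lemma card_separated_le_covering_number:
  fixes A :: "'a::euclidean_space set"
  assumes "bounded A" "r > 0" "P \<subseteq> A" and sep: "\<And>x y. x \<in> P \<Longrightarrow> y \<in> P \<Longrightarrow> x \<noteq> y \<Longrightarrow> dist x y > 2 * r"
  shows "card P \<le> covering_number r A"
proof -
  have "compact (closure A)" using \<open>bounded A\<close> by (simp add: compact_closure)
  moreover have "closure A \<subseteq> (\<Union>c\<in>closure A. ball c r)" using \<open>r > 0\<close> by auto
  ultimately obtain C where C: "finite C" "closure A \<subseteq> (\<Union>c\<in>C. ball c r)"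
    by (elim compactE_image[where f = "\<lambda>c. ball c r"]) auto
  moreover have "(\<Union>c\<in>C. ball c r) \<subseteq> (\<Union>c\<in>C. cball c r)"
    by (intro UN_mono) auto
  ultimately have "finite C \<and> card C = card C \<and> A \<subseteq> (\<Union>c\<in>C. cball c r)"
    using closure_subset[of A] by blast
  then have "\<exists>n C. finite C \<and> card C = n \<and> A \<subseteq> (\<Union>c\<in>C. cball c r)" by blast
  from LeastI_ex[OF this] obtain D where
    D: "finite D" "card D = covering_number r A" "A \<subseteq> (\<Union>c\<in>D. cball c r)"
    unfolding covering_number_def by blast
  have "\<forall>x\<in>P. \<exists>d\<in>D. dist d x \<le> r" using D(3) \<open>P \<subseteq> A\<close> by fastforce
  then obtain f where f: "\<And>x. x \<in> P \<Longrightarrow> f x \<in> D \<and> dist (f x) x \<le> r" by metis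
  have "inj_on f P"
  proof (rule inj_onI, rule ccontr)
    fix x y assume xy: "x \<in> P" "y \<in> P" "f x = f y" "x \<noteq> y"
    have "dist x y \<le> dist (f x) x + dist (f y) y"
      using xy(3) dist_triangle2[of x y "f x"] by (simp add: dist_commute)
    with f[OF xy(1)] f[OF xy(2)] sep[OF xy(1,2,4)] show False by linarith
  qed
  then have "card P \<le> card D" using f D(1) by (intro card_inj_on_le[of f]) auto
  then show ?thesis using D(2) by simp
qed

text \<open>Finds the level of the self-similar construction that matches a scale \<open>x\<close>.
  The least exponent \<open>k\<close> with \<open>\<rho> ^ k < x\<close> is positive because
  \<open>x \<le> 1\<close>, so it has a predecessor.\<close>

lemma power_interval:
  fixes \<rho> x :: real
  assumes "0 < \<rho>" "\<rho> < 1" "0 < x" "x \<le> 1"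
  obtains m where "\<rho> ^ Suc m < x" "x \<le> \<rho> ^ m"
proof -
  define k where "k = (LEAST k. \<rho> ^ k < x)"
  have ex: "\<exists>k. \<rho> ^ k < x" using real_arch_pow_inv assms by blast
  have k: "\<rho> ^ k < x" unfolding k_def using ex by (rule LeastI_ex)
  then have "k \<noteq> 0" using assms by (intro notI) simp
  then obtain m where m: "k = Suc m" by (cases k) auto
  then have "\<not> \<rho> ^ m < x" using not_less_Least[of m "\<lambda>k. \<rho> ^ k < x"] k_def by simp
  with k m that show thesis by auto
qed

text \<open>Pigeonhole on half-open cells of length \<open>\<delta>\<close>, each of which holds at
  most one value. As the right endpoint of the interval is allowed, there are \<open>L + 1\<close>
  cells.\<close>

lemma card_separated_reals_le:
  fixes f :: "'b \<Rightarrow> real" and A \<delta> :: real and L :: nat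
  assumes "0 < \<delta>" and range: "\<And>i. i \<in> J \<Longrightarrow> A \<le> f i \<and> f i \<le> A + L * \<delta>"
    and sep: "\<And>i j. i \<in> J \<Longrightarrow> j \<in> J \<Longrightarrow> i \<noteq> j \<Longrightarrow> \<delta> \<le> \<bar>f i - f j\<bar>"
  shows "card J \<le> Suc L"
proof -
  define g where "g i = \<lfloor>(f i - A) / \<delta>\<rfloor>" for i
  have "inj_on g J"
  proof (rule inj_onI, rule ccontr)
    fix i j assume ij: "i \<in> J" "j \<in> J" "g i = g j" "i \<noteq> j"
    then have "\<bar>(f i - A) / \<delta> - (f j - A) / \<delta>\<bar> < 1"
      unfolding g_def by linarith
    then have "\<bar>f i - f j\<bar> / \<delta> < 1"
      using \<open>0 < \<delta>\<close> by (simp flip: diff_divide_distrib)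
    with sep[OF ij(1,2,4)] \<open>0 < \<delta>\<close> show False by (simp add: field_simps)
  qed
  moreover have "g ` J \<subseteq> {0..int L}"
  proof safe
    fix i assume "i \<in> J"
    then have "0 \<le> (f i - A) / \<delta>" "(f i - A) / \<delta> \<le> L"
      using range \<open>0 < \<delta>\<close> by (auto simp: field_simps)
    then show "g i \<in> {0..int L}" unfolding g_def by (auto simp: floor_le_iff)
  qed
  ultimately have "card J \<le> card {0..int L}" by (intro card_inj_on_le[of g]) auto
  then show ?thesis by simp
qed

lemma power4_separated:
  assumes "i < j"
  shows "(4::real) ^ j \<ge> 4 * 4 ^ i" "(4::real) ^ j - 4 ^ i \<ge> 3"
proof -
  have "(4::real) ^ Suc i \<le> 4 ^ j" using assms by (intro power_increasing) auto
  then show *: "(4::real) ^ j \<ge> 4 * 4 ^ i" by simp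
  have "(4::real) ^ i \<ge> 1" by simp
  with * show "(4::real) ^ j - 4 ^ i \<ge> 3" by linarith
qed

lemma ln_4_ge_1: "1 \<le> ln (4::real)"
  using exp_le by (subst ln_ge_iff) auto

text \<open>The elements of \<open>T\<close> exceed the least one by at most the logarithm of
  \<open>B\<close> to base 4, and \<open>1 \<le> ln 4\<close> allows the cruder bound
  \<open>ln B\<close>. This counts the indices whose shift is neither invisible nor
  isolating.\<close>

lemma card_power_window_le:
  fixes B :: real
  assumes "B \<ge> 1" and T: "\<And>i j. i \<in> T \<Longrightarrow> j \<in> T \<Longrightarrow> i \<le> j \<Longrightarrow> 4 ^ j \<le> B * 4 ^ i"
  shows "finite T" "card T \<le> 1 + ln B"
proof -
  have lnB: "0 \<le> ln B" using \<open>B \<ge> 1\<close> by simp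
  have "finite T \<and> card T \<le> 1 + ln B"
  proof (cases "T = {}")
    case False
    define i where "i = (LEAST i. i \<in> T)"
    have i: "i \<in> T" unfolding i_def using False LeastI_ex[of "\<lambda>i. i \<in> T"] by blast
    have "T \<subseteq> {i..i + nat \<lfloor>ln B\<rfloor>}"
    proof
      fix j assume j: "j \<in> T"
      then have le: "i \<le> j" unfolding i_def by (rule Least_le)
      then have "4 ^ j = (4::real) ^ (j - i) * 4 ^ i" by (simp flip: power_add)
      with T[OF i j le] have "4 ^ (j - i) \<le> B" by simp
      then have "ln (4 ^ (j - i)) \<le> ln B" using \<open>B \<ge> 1\<close> by (subst ln_le_cancel_iff) auto
      then have "real (j - i) * ln 4 \<le> ln B" by (simp add: ln_realpow)
      moreover have "real (j - i) * 1 \<le> real (j - i) * ln 4" using ln_4_ge_1 by (intro mult_left_mono) auto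
      ultimately have "real (j - i) \<le> ln B" by linarith
      then have "j - i \<le> nat \<lfloor>ln B\<rfloor>" by (simp add: le_nat_floor)
      then show "j \<in> {i..i + nat \<lfloor>ln B\<rfloor>}" using le by auto
    qed
    moreover from this have "card T \<le> card {i..i + nat \<lfloor>ln B\<rfloor>}" by (intro card_mono) auto
    moreover have "real (nat \<lfloor>ln B\<rfloor>) \<le> ln B" using lnB by simp
    ultimately show ?thesis using finite_subset by fastforce
  qed (use lnB in auto)
  then show "finite T" "card T \<le> 1 + ln B" by auto
qed

section \<open>Digit sums and their separation\<close>

text \<open>The digit sum \<open>\<Sum>\<^sub>k b\<^sub>k * \<rho> ^ k\<close>, where \<open>b\<^sub>k\<close> are the binary digits of the index.\<close>

fun cantor_point :: "real \<Rightarrow> nat \<Rightarrow> real" where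
  "cantor_point \<rho> n = (if n = 0 then 0 else real (n mod 2) + \<rho> * cantor_point \<rho> (n div 2))"

declare cantor_point.simps [simp del]

lemma cantor_point_0 [simp]: "cantor_point \<rho> 0 = 0"
  by (simp add: cantor_point.simps)

lemma cantor_point_rec:
  "cantor_point \<rho> n = real (n mod 2) + \<rho> * cantor_point \<rho> (n div 2)"
  by (cases "n = 0") (simp_all add: cantor_point.simps[of \<rho> n])

text \<open>Multiplying the index by \<open>2 ^ m\<close> puts \<open>m\<close> zeros in front of
  its digits, the least significant digit being the first.\<close>

lemma cantor_point_power_mult: "cantor_point \<rho> (2 ^ m * n) = \<rho> ^ m * cantor_point \<rho> n"
proof (induction m)
  case (Suc m)
  then show ?case by (subst cantor_point_rec) (simp add: mult.assoc)
qed simp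

text \<open>The residue holds the first \<open>m\<close> digits and the quotient the remaining
  ones.\<close>

lemma cantor_point_split:
  "cantor_point \<rho> n = cantor_point \<rho> (n mod 2 ^ m) + \<rho> ^ m * cantor_point \<rho> (n div 2 ^ m)"
proof (induction m arbitrary: n)
  case (Suc m)
  have "cantor_point \<rho> (n mod 2 ^ Suc m) = real (n mod 2) + \<rho> * cantor_point \<rho> (n div 2 mod 2 ^ m)"
    by (subst cantor_point_rec) (simp add: mod_mult2_eq)
  then show ?case
    using Suc[of "n div 2"] cantor_point_rec[of \<rho> n]
    by (simp add: div_mult2_eq algebra_simps)
qed simp

lemma cantor_point_nonneg: "0 \<le> \<rho> \<Longrightarrow> 0 \<le> cantor_point \<rho> n"
proof (induction n rule: less_induct)
  case (less n)
  then show ?case by (cases "n = 0") (simp_all add: cantor_point_rec[of \<rho> n])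
qed

lemma cantor_point_le_2:
  assumes "0 \<le> \<rho>" "\<rho> \<le> 1/2"
  shows "cantor_point \<rho> n \<le> 2"
proof (induction n rule: less_induct)
  case (less n)
  show ?case
  proof (cases "n = 0")
    case False
    then have "\<rho> * cantor_point \<rho> (n div 2) \<le> 1/2 * 2"
      using assms less[of "n div 2"] by (intro mult_mono cantor_point_nonneg) auto
    moreover have "real (n mod 2) \<le> 1" by simp
    ultimately show ?thesis by (simp add: cantor_point_rec[of \<rho> n])
  qed simp
qed

text \<open>The geometric sum \<open>\<rho> + ... + \<rho> ^ m\<close> is
  \<open>\<rho> / (1 - \<rho>)\<close> times \<open>1 - \<rho> ^ m\<close>, and this factor is at
  most 1. Hence the digits after the first fall short of a unit by at least
  \<open>\<rho> ^ m\<close>.\<close>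

lemma cantor_point_prefix_le:
  assumes "0 \<le> \<rho>" "\<rho> \<le> 1/2" "n < 2 ^ m"
  shows "\<rho> * cantor_point \<rho> n \<le> 1 - \<rho> ^ m"
  using assms(3)
proof (induction m arbitrary: n)
  case (Suc m)
  have "\<rho> * cantor_point \<rho> (n div 2) \<le> 1 - \<rho> ^ m" using Suc by simp
  moreover have "real (n mod 2) \<le> 1" by simp
  ultimately have "cantor_point \<rho> n \<le> 2 - \<rho> ^ m" unfolding cantor_point_rec[of \<rho> n] by linarith
  then have "\<rho> * cantor_point \<rho> n \<le> \<rho> * (2 - \<rho> ^ m)" using assms(1) by (rule mult_left_mono)
  then show ?case using assms(2) by (simp add: algebra_simps)
qed simp

text \<open>If the first digits agree, the difference of the tails is scaled by
  \<open>\<rho>\<close>; if they differ, the tails cannot make up for the unit between them. This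
  includes \<open>\<rho> = 1/2\<close>, where the two halves of the limit set touch, because only
  \<open>m\<close> digits occur.\<close>

lemma cantor_point_separated:
  assumes "0 \<le> \<rho>" "\<rho> \<le> 1/2" "i < 2 ^ m" "j < 2 ^ m" "i \<noteq> j"
  shows "\<rho> ^ m \<le> \<bar>cantor_point \<rho> i - cantor_point \<rho> j\<bar>"
  using assms(3-5)
proof (induction m arbitrary: i j)
  case (Suc m)
  have lt: "i div 2 < 2 ^ m" "j div 2 < 2 ^ m" using Suc.prems by auto
  note pre = cantor_point_prefix_le[OF assms(1,2) lt(1)] cantor_point_prefix_le[OF assms(1,2) lt(2)]
    mult_nonneg_nonneg[OF assms(1) cantor_point_nonneg[OF assms(1)], of "i div 2"]
    mult_nonneg_nonneg[OF assms(1) cantor_point_nonneg[OF assms(1)], of "j div 2"]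
  note rec = cantor_point_rec[of \<rho> i] cantor_point_rec[of \<rho> j]
  have pow: "\<rho> ^ Suc m \<le> \<rho> ^ m" using assms by (intro power_decreasing) auto
  show ?case
  proof (cases "i mod 2 = j mod 2")
    case True
    then have "i div 2 \<noteq> j div 2" using Suc.prems(3) by (metis mult_div_mod_eq)
    with Suc.IH[OF lt] have "\<rho> * \<rho> ^ m \<le> \<rho> * \<bar>cantor_point \<rho> (i div 2) - cantor_point \<rho> (j div 2)\<bar>"
      using assms(1) by (intro mult_left_mono) auto
    also have "\<dots> = \<bar>cantor_point \<rho> i - cantor_point \<rho> j\<bar>"
      using True rec assms(1) by (simp add: abs_mult flip: right_diff_distrib)
    finally show ?thesis by simp
  next
    case False
    then consider "i mod 2 = 1" "j mod 2 = 0" | "i mod 2 = 0" "j mod 2 = 1" by fastforce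
    then show ?thesis using rec pre pow by cases linarith+
  qed
qed simp

text \<open>Two copies scaled by this ratio have similarity dimension \<open>s\<close>.\<close>

definition cantor_ratio :: "real \<Rightarrow> real" where
  "cantor_ratio s = 2 powr (- 1 / s)"

lemma cantor_ratio_pos: "0 < cantor_ratio s"
  by (simp add: cantor_ratio_def)

lemma cantor_ratio_le_half:
  assumes "0 < s" "s \<le> 1"
  shows "cantor_ratio s \<le> 1/2"
proof -
  have "2 powr (- 1 / s) \<le> 2 powr (- 1 :: real)"
    using assms by (intro powr_mono) (auto simp: field_simps)
  then show ?thesis by (simp add: cantor_ratio_def powr_minus)
qed

text \<open>The similarity equation \<open>\<rho> powr s = 1/2\<close>, raised to a power; it turns
  ratios of scales into numbers of digit words.\<close>

lemma cantor_ratio_power_powr: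
  assumes "0 < s"
  shows "(cantor_ratio s ^ n) powr s = 1 / 2 ^ n"
proof -
  have "(cantor_ratio s ^ n) powr s = (cantor_ratio s powr s) ^ n"
    using cantor_ratio_pos[of s] by (simp add: powr_realpow[symmetric] powr_powr mult.commute)
  also have "cantor_ratio s powr s = 1/2"
    using assms powr_powr[of 2 "- 1 / s" s] by (simp add: cantor_ratio_def powr_minus_divide)
  finally show ?thesis by (simp add: power_divide)
qed

section \<open>Covering estimates for the self-similar set and its sheared copies\<close>

text \<open>The levels \<open>m\<close> and \<open>n\<close> match the scales \<open>R\<close> and
  \<open>r\<close>. Near \<open>y\<close> only boundedly many prefixes of length \<open>m\<close>
  occur, and each has at most \<open>2 ^ (n - m)\<close> continuations to length \<open>n\<close>;
  the points of these longer prefixes serve as centres.\<close>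

lemma cantor_point_cover:
  fixes s r R y :: real
  assumes s: "0 < s" "s \<le> 1" and rR: "0 < r" "r \<le> R" "R \<le> 4"
  obtains K where "finite K" "card K \<le> 52 * (R / r) powr s"
    "\<And>i. \<bar>cantor_point (cantor_ratio s) i - y\<bar> \<le> R \<Longrightarrow>
      \<exists>k\<in>K. \<bar>cantor_point (cantor_ratio s) i - k\<bar> \<le> r"
proof -
  define \<rho> where "\<rho> = cantor_ratio s"
  define c where "c = cantor_point \<rho>"
  have \<rho>: "0 < \<rho>" "\<rho> \<le> 1/2" "\<rho> < 1"
    using cantor_ratio_pos[of s] cantor_ratio_le_half[OF s] by (auto simp: \<rho>_def)
  have c: "0 \<le> c i" "c i \<le> 2" for i
    using \<rho> by (auto simp: c_def cantor_point_nonneg cantor_point_le_2)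
  \<comment> \<open>Division by 4 brings \<open>R\<close> into the range of
    \<open>power_interval\<close>; for \<open>r\<close> it makes the tail bound
    \<open>2 * \<rho> ^ n\<close> smaller than \<open>r\<close>.\<close>
  obtain m where m: "\<rho> ^ Suc m < R / 4" "R / 4 \<le> \<rho> ^ m"
    using power_interval[of \<rho> "R / 4"] \<rho> rR by auto
  obtain n' where n': "\<rho> ^ Suc n' < r / 4" "r / 4 \<le> \<rho> ^ n'"
    using power_interval[of \<rho> "r / 4"] \<rho> rR by auto
  define n where "n = Suc n'"
  have "m < n"
  proof (rule ccontr)
    assume "\<not> m < n"
    then have "\<rho> ^ m \<le> \<rho> ^ n" using \<rho> by (intro power_decreasing) auto
    then show False using m n' rR unfolding n_def by linarith
  qed
  define S where "S = {i. \<bar>c i - y\<bar> \<le> R}"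
  define J where "J k = (\<lambda>i. i mod 2 ^ k) ` S" for k :: nat
  have J_sub: "J k \<subseteq> {..<2 ^ k}" for k by (auto simp: J_def)
  then have finJ: "finite (J k)" for k using finite_subset by blast
  have close: "\<bar>c i - c (i mod 2 ^ k)\<bar> \<le> 2 * \<rho> ^ k" for i k
    using cantor_point_split[of \<rho> i k] c[of "i div 2 ^ k"] \<rho> mult_left_mono[of "c (i div 2 ^ k)" 2 "\<rho> ^ k"]
    by (simp add: c_def abs_mult mult.commute)
  \<comment> \<open>A prefix point is within \<open>2 * \<rho> ^ m\<close> of a point that is within
    \<open>R \<le> 4 * \<rho> ^ m\<close> of \<open>y\<close>, so all of them lie in an interval of
    length \<open>12 * \<rho> ^ m\<close>.\<close>
  have "card (J m) \<le> Suc 12"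
  proof (rule card_separated_reals_le[where f = c and A = "y - 6 * \<rho> ^ m" and \<delta> = "\<rho> ^ m"])
    show "0 < \<rho> ^ m" using \<rho> by simp
    fix i assume "i \<in> J m"
    then obtain i' where i': "i = i' mod 2 ^ m" "\<bar>c i' - y\<bar> \<le> R" by (auto simp: J_def S_def)
    then show "y - 6 * \<rho> ^ m \<le> c i \<and> c i \<le> y - 6 * \<rho> ^ m + real 12 * \<rho> ^ m"
      using close[of i' m] m by auto
  next
    fix i j assume "i \<in> J m" "j \<in> J m" "i \<noteq> j"
    then show "\<rho> ^ m \<le> \<bar>c i - c j\<bar>"
      using J_sub[of m] \<rho> unfolding c_def by (intro cantor_point_separated) auto
  qed
  define f where "f j = (j mod 2 ^ m, j div 2 ^ m)" for j :: nat
  have "inj_on f (J n)" by (rule inj_onI) (metis f_def prod.inject mult_div_mod_eq)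
  moreover have "f ` J n \<subseteq> J m \<times> {..<2 ^ (n - m)}"
  proof (rule image_subsetI)
    fix j assume j: "j \<in> J n"
    then obtain i where i: "i \<in> S" "j = i mod 2 ^ n" by (auto simp: J_def)
    have "(2::nat) ^ m dvd 2 ^ n" using \<open>m < n\<close> by (simp add: le_imp_power_dvd)
    then have "j mod 2 ^ m = i mod 2 ^ m" using i by (simp add: mod_mod_cancel)
    moreover have "j < 2 ^ (n - m) * 2 ^ m" using j J_sub[of n] \<open>m < n\<close> by (auto simp flip: power_add)
    then have "j div 2 ^ m < 2 ^ (n - m)" by (rule less_mult_imp_div_less)
    ultimately show "f j \<in> J m \<times> {..<2 ^ (n - m)}" using i by (auto simp: f_def J_def)
  qed
  ultimately have "card (J n) \<le> card (J m \<times> {..<(2::nat) ^ (n - m)})"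
    using finJ by (intro card_inj_on_le[of f]) auto
  also have "\<dots> \<le> 13 * 2 ^ (n - m)" using \<open>card (J m) \<le> Suc 12\<close> by (simp add: card_cartesian_product)
  finally have cardJ: "real (card (J n)) \<le> 13 * 2 ^ (n - m)"
    by (metis of_nat_le_iff of_nat_mult of_nat_numeral of_nat_power)
  have "2 ^ (n - m) = 2 ^ n / (2 ^ m :: real)" using \<open>m < n\<close> by (simp add: power_diff)
  also have "\<dots> = (\<rho> ^ m / \<rho> ^ n) powr s"
    using \<rho> s by (simp add: powr_divide cantor_ratio_power_powr \<rho>_def)
  \<comment> \<open>Rounding \<open>R\<close> and \<open>r\<close> to levels costs one factor
    \<open>\<rho>\<close> each. Since \<open>(1 / \<rho> ^ 2) powr s = 4\<close>, the final constant
    is \<open>13 * 4 = 52\<close>.\<close>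
  also have "\<dots> \<le> ((1 / \<rho> ^ 2) * (R / r)) powr s"
  proof (intro powr_mono2)
    have "\<rho> ^ m * (\<rho> * r) \<le> R * \<rho> ^ n'"
      using m n' \<rho> rR mult_mono[of "4 * \<rho> ^ Suc m" R "r" "4 * \<rho> ^ n'"] by (simp add: algebra_simps)
    then have "\<rho> ^ m / \<rho> ^ n' \<le> (R / r) / \<rho>" using \<rho> rR by (simp add: field_simps)
    then show "\<rho> ^ m / \<rho> ^ n \<le> (1 / \<rho> ^ 2) * (R / r)"
      using \<rho> rR by (simp add: n_def field_simps power2_eq_square)
  qed (use \<rho> s in auto)
  also have "\<dots> = (1 / \<rho> ^ 2) powr s * (R / r) powr s"
    by (rule powr_mult)
  also have "(1 / \<rho> ^ 2) powr s = 4"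
    unfolding powr_divide \<rho>_def cantor_ratio_power_powr[OF s(1)] by simp
  finally have "real (card (J n)) \<le> 52 * (R / r) powr s" using cardJ by linarith
  then have "real (card (c ` J n)) \<le> 52 * (R / r) powr s"
    using card_image_le[OF finJ, of c n] by linarith
  moreover have "\<exists>k\<in>c ` J n. \<bar>c i - k\<bar> \<le> r" if "\<bar>c i - y\<bar> \<le> R" for i
    using that close[of i n] n' rR by (intro bexI[of _ "c (i mod 2 ^ n)"]) (auto simp: J_def S_def n_def)
  ultimately show thesis
    using that[of "c ` J n"] finJ by (auto simp: c_def \<rho>_def)
qed

text \<open>Indices with small shift are covered through their digit sums. Every other index in the
  window gets its own ball: at most \<open>1 + ln (8 / r)\<close> for the middle range
  \<open>T2\<close> and one for \<open>T3\<close>.\<close>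

lemma covering_number_cantor_piece_le:
  fixes Y :: "real set"
  assumes s: "0 < s" "s \<le> 1" and a: "1/2 \<le> \<bar>a\<bar>" "\<bar>a\<bar> \<le> 1"
    and rR: "0 < r" "r \<le> R" "R < 1"
    and sub: "Y \<inter> cball x 1 \<subseteq> range (\<lambda>i. a * (p + cantor_point (cantor_ratio s) i + \<tau> * 4 ^ i))"
  shows "covering_number r (Y \<inter> cball x R) \<le> 312 * (R / r) powr s + 2 + ln (8 / r)"
proof -
  define c where "c = cantor_point (cantor_ratio s)"
  define z where "z i = p + c i + \<tau> * 4 ^ i" for i
  define y where "y = x / a"
  \<comment> \<open>Because \<open>1/2 \<le> \<bar>a\<bar>\<close>, division by \<open>a\<close> at
    most doubles the radius.\<close>
  define T where "T = {i. \<bar>z i - y\<bar> \<le> 2 * R}"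
  define T2 where "T2 = {i \<in> T. r / 2 < \<bar>\<tau>\<bar> * 4 ^ i \<and> \<bar>\<tau>\<bar> * 4 ^ i \<le> 4}"
  define T3 where "T3 = {i \<in> T. 4 < \<bar>\<tau>\<bar> * 4 ^ i}"
  have c: "0 \<le> c i" "c i \<le> 2" for i
    using cantor_ratio_pos[of s] cantor_ratio_le_half[OF s]
    by (auto simp: c_def cantor_point_nonneg cantor_point_le_2)
  have "a \<noteq> 0" using a by auto
  have T: "i \<in> T" if "a * z i \<in> cball x R" for i
  proof -
    have "x - a * z i = a * (y - z i)" using \<open>a \<noteq> 0\<close> by (simp add: y_def algebra_simps)
    with that have "\<bar>a\<bar> * \<bar>y - z i\<bar> \<le> R" by (simp add: dist_real_def abs_mult)
    moreover have "1/2 * \<bar>y - z i\<bar> \<le> \<bar>a\<bar> * \<bar>y - z i\<bar>" using a by (intro mult_right_mono) auto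
    ultimately show ?thesis unfolding T_def by simp
  qed
  \<comment> \<open>The shifts of two such indices would differ by more than 12, but the window
    allows at most \<open>4 * R\<close> and the digit sums at most 2.\<close>
  have "i = j" if "i \<in> T3" "j \<in> T3" "i \<le> j" for i j
  proof (rule ccontr)
    assume "i \<noteq> j"
    then have "(4::real) ^ j \<ge> 4 * 4 ^ i" using that by (intro power4_separated) auto
    then have "\<bar>\<tau>\<bar> * (4 * 4 ^ i) \<le> \<bar>\<tau>\<bar> * 4 ^ j" by (intro mult_left_mono) auto
    moreover have "\<bar>\<tau> * 4 ^ j\<bar> \<le> \<bar>\<tau> * 4 ^ i\<bar> + \<bar>z j - y\<bar> + \<bar>z i - y\<bar> + 2"
      using c[of i] c[of j] unfolding z_def by linarith
    ultimately show False using that rR by (simp add: T3_def T_def abs_mult)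
  qed
  then have "\<And>i j. i \<in> T3 \<Longrightarrow> j \<in> T3 \<Longrightarrow> i = j" by (metis nat_le_linear)
  then obtain i3 where "T3 \<subseteq> {i3}" by blast
  then have T3: "finite T3" "card T3 \<le> 1"
    using finite_subset card_mono[of "{i3}" T3] by auto
  have "1 \<le> 8 / r" using rR by simp
  \<comment> \<open>\<open>8 / r\<close> is the ratio of the thresholds 4 and \<open>r / 2\<close>
    in \<open>T2\<close>.\<close>
  moreover have "4 ^ j \<le> 8 / r * 4 ^ i" if "i \<in> T2" "j \<in> T2" for i j
  proof -
    have "\<bar>\<tau>\<bar> > 0" using that rR by (cases "\<tau> = 0") (auto simp: T2_def)
    have "\<bar>\<tau>\<bar> * 4 ^ j \<le> 8 / r * (r / 2)" using that rR by (simp add: T2_def)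
    also have "\<dots> \<le> 8 / r * (\<bar>\<tau>\<bar> * 4 ^ i)" using that rR by (intro mult_left_mono) (auto simp: T2_def)
    finally have "\<bar>\<tau>\<bar> * 4 ^ j \<le> \<bar>\<tau>\<bar> * (8 / r * 4 ^ i)" by (simp add: mult.left_commute)
    then show ?thesis using \<open>\<bar>\<tau>\<bar> > 0\<close> mult_le_cancel_left_pos by blast
  qed
  ultimately have T2: "finite T2" "card T2 \<le> 1 + ln (8 / r)"
    using card_power_window_le[of "8 / r" T2] by blast+
  \<comment> \<open>Half of the radius \<open>r\<close> is kept for the shift; the same shift
    enlarges the window to \<open>2 * R + r / 2 \<le> 3 * R\<close>.\<close>
  obtain K where K: "finite K" "card K \<le> 52 * (3 * R / (r / 2)) powr s"
    "\<And>i. \<bar>c i - (y - p)\<bar> \<le> 3 * R \<Longrightarrow> \<exists>k\<in>K. \<bar>c i - k\<bar> \<le> r / 2"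
    using cantor_point_cover[OF s, of "r / 2" "3 * R" "y - p"] rR unfolding c_def by auto
  define D where "D = (\<lambda>k. a * (p + k)) ` K \<union> (\<lambda>i. a * z i) ` (T2 \<union> T3)"
  have "Y \<inter> cball x R \<subseteq> (\<Union>d\<in>D. cball d r)"
  proof
    fix v assume v: "v \<in> Y \<inter> cball x R"
    then have "v \<in> Y \<inter> cball x 1" using rR by auto
    then obtain i where i: "v = a * z i" using sub unfolding z_def c_def by blast
    then have "i \<in> T" using T v by auto
    then consider "i \<in> T2 \<union> T3" | "\<bar>\<tau>\<bar> * 4 ^ i \<le> r / 2" unfolding T2_def T3_def by fastforce
    then show "v \<in> (\<Union>d\<in>D. cball d r)"
    proof cases
      case 1
      then have "v \<in> D" by (auto simp: D_def i)
      moreover have "v \<in> cball v r" using rR by simp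
      ultimately show ?thesis by blast
    next
      case 2
      then have small: "\<bar>\<tau> * 4 ^ i\<bar> \<le> r / 2" by (simp add: abs_mult)
      then have "\<bar>c i - (y - p)\<bar> \<le> 3 * R" using \<open>i \<in> T\<close> rR unfolding T_def z_def by auto
      then obtain k where k: "k \<in> K" "\<bar>c i - k\<bar> \<le> r / 2" using K(3) by blast
      have "\<bar>a * (p + k) - a * z i\<bar> = \<bar>a\<bar> * \<bar>k - c i - \<tau> * 4 ^ i\<bar>"
        unfolding z_def by (simp add: algebra_simps flip: abs_mult)
      also have "\<dots> \<le> 1 * r"
      proof (rule mult_mono)
        show "\<bar>k - c i - \<tau> * 4 ^ i\<bar> \<le> r" using k(2) small by linarith
      qed (use a in auto)
      finally have "v \<in> cball (a * (p + k)) r" by (simp add: i dist_real_def)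
      then show ?thesis using k(1) by (auto simp: D_def)
    qed
  qed
  then have "covering_number r (Y \<inter> cball x R) \<le> card D"
    using K(1) T2(1) T3(1) by (intro covering_number_le) (auto simp: D_def)
  also have "card D \<le> card K + (card T2 + card T3)"
    unfolding D_def
    by (intro order_trans[OF card_Un_le] add_mono card_image_le K(1)
          order_trans[OF card_image_le card_Un_le]) (use T2 T3 in auto)
  finally have "real (covering_number r (Y \<inter> cball x R)) \<le> 52 * (3 * R / (r / 2)) powr s + 2 + ln (8 / r)"
    using K(2) T2(2) T3(2) by linarith
  also have "(3 * R / (r / 2)) powr s = 6 powr s * (R / r) powr s"
    using rR by (simp flip: powr_mult)
  also have "6 powr s * (R / r) powr s \<le> 6 powr 1 * (R / r) powr s"
    using s by (intro mult_right_mono powr_mono) auto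
  finally show ?thesis by simp
qed

text \<open>The indices \<open>2 ^ m * i\<close> with \<open>i < 2 ^ l\<close> have \<open>m\<close>
  leading zero digits. Their digit sums form a copy of level \<open>l\<close> scaled by
  \<open>\<rho> ^ m\<close>, with gaps at least \<open>\<rho> ^ (m + l)\<close>, and a sufficiently
  small shear preserves enough of these gaps.\<close>

lemma covering_number_cantor_piece_ge:
  fixes Y :: "real set" and s a r :: real
  defines "\<rho> \<equiv> cantor_ratio s"
  assumes s: "0 < s" "s \<le> 1" and a: "1/2 \<le> \<bar>a\<bar>" "\<bar>a\<bar> \<le> 1"
    and r: "0 < r" "8 * r < \<rho> ^ (m + l)"
    and approx: "\<And>N \<epsilon>. 0 < \<epsilon> \<Longrightarrow>
      \<exists>p \<tau>. \<bar>\<tau>\<bar> < \<epsilon> \<and> (\<forall>i\<le>N. a * (p + cantor_point \<rho> i + \<tau> * 4 ^ i) \<in> Y)"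
  shows "\<exists>x\<in>Y. 2 ^ l \<le> covering_number r (Y \<inter> cball x (3 * \<rho> ^ m))"
proof -
  define c where "c = cantor_point \<rho>"
  have \<rho>: "0 < \<rho>" "\<rho> \<le> 1/2" "\<rho> < 1"
    using cantor_ratio_pos[of s] cantor_ratio_le_half[OF s] by (auto simp: \<rho>_def)
  have c: "0 \<le> c i" "c i \<le> 2" for i
    using \<rho> by (auto simp: c_def cantor_point_nonneg cantor_point_le_2)
  define N :: nat where "N = 2 ^ (m + l)"
  \<comment> \<open>Up to index \<open>N\<close> every shift is then at most
    \<open>\<rho> ^ (m + l) / 8\<close>. Two shifts cost a quarter of the gap, which leaves more
    than \<open>4 * r\<close>, and more than \<open>2 * r\<close> after multiplication by
    \<open>a\<close>.\<close>
  obtain p \<tau> where \<tau>: "\<bar>\<tau>\<bar> < \<rho> ^ (m + l) / 8 / 4 ^ N"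
    and Y: "\<And>i. i \<le> N \<Longrightarrow> a * (p + c i + \<tau> * 4 ^ i) \<in> Y"
    using approx[of "\<rho> ^ (m + l) / 8 / 4 ^ N" N] \<rho> unfolding c_def by auto
  define z where "z i = p + c i + \<tau> * 4 ^ i" for i
  have err: "\<bar>\<tau> * 4 ^ i\<bar> \<le> \<rho> ^ (m + l) / 8" if "i \<le> N" for i
  proof -
    have "\<bar>\<tau>\<bar> * 4 ^ i \<le> (\<rho> ^ (m + l) / 8 / 4 ^ N) * 4 ^ N"
      using \<tau> that by (intro mult_mono power_increasing) auto
    then show ?thesis by (simp add: abs_mult)
  qed
  have le_N: "2 ^ m * i \<le> N" if "i < 2 ^ l" for i
    using that unfolding N_def power_add by simp
  have pow: "\<rho> ^ (m + l) \<le> \<rho> ^ m" using \<rho> by (intro power_decreasing) auto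
  define P where "P = (\<lambda>i. a * z (2 ^ m * i)) ` {..<2 ^ l}"
  have sep: "\<bar>a * z (2 ^ m * i) - a * z (2 ^ m * j)\<bar> > 2 * r" if "i < 2 ^ l" "j < 2 ^ l" "i \<noteq> j" for i j
  proof -
    have "\<rho> ^ m * \<rho> ^ l \<le> \<rho> ^ m * \<bar>c i - c j\<bar>"
      unfolding c_def using that \<rho> by (intro mult_left_mono cantor_point_separated) auto
    also have "\<dots> = \<bar>c (2 ^ m * i) - c (2 ^ m * j)\<bar>"
      using \<rho> by (simp add: c_def cantor_point_power_mult abs_mult flip: right_diff_distrib)
    finally have "\<bar>z (2 ^ m * i) - z (2 ^ m * j)\<bar> > 4 * r"
      using err[OF le_N[OF that(1)]] err[OF le_N[OF that(2)]] r unfolding z_def power_add by linarith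
    moreover have "1/2 * \<bar>z (2 ^ m * i) - z (2 ^ m * j)\<bar> \<le> \<bar>a\<bar> * \<bar>z (2 ^ m * i) - z (2 ^ m * j)\<bar>"
      using a by (intro mult_right_mono) auto
    ultimately show ?thesis by (simp flip: abs_mult right_diff_distrib)
  qed
  have "inj_on (\<lambda>i. a * z (2 ^ m * i)) {..<2 ^ l}"
    by (rule inj_onI, rule ccontr) (use sep r in fastforce)
  then have "card P = 2 ^ l" by (simp add: P_def card_image)
  have "P \<subseteq> Y \<inter> cball (a * z 0) (3 * \<rho> ^ m)"
  proof
    fix v assume "v \<in> P"
    then obtain i where i: "i < 2 ^ l" "v = a * z (2 ^ m * i)" by (auto simp: P_def)
    have "\<rho> ^ m * c i \<le> \<rho> ^ m * 2" using c \<rho> by (intro mult_left_mono) auto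
    moreover have "0 \<le> \<rho> ^ m * c i" using c \<rho> by simp
    ultimately have "\<bar>z 0 - z (2 ^ m * i)\<bar> \<le> 3 * \<rho> ^ m"
      using err[OF le_N[OF i(1)]] err[of 0] pow unfolding z_def c_def
      by (simp add: cantor_point_power_mult)
    then have "\<bar>a\<bar> * \<bar>z 0 - z (2 ^ m * i)\<bar> \<le> 1 * (3 * \<rho> ^ m)" using a by (intro mult_mono) auto
    then have "v \<in> cball (a * z 0) (3 * \<rho> ^ m)"
      by (simp add: i(2) dist_real_def flip: abs_mult right_diff_distrib)
    then show "v \<in> Y \<inter> cball (a * z 0) (3 * \<rho> ^ m)"
      using Y[OF le_N[OF i(1)]] i(2) by (simp add: z_def)
  qed
  moreover have "dist v w > 2 * r" if "v \<in> P" "w \<in> P" "v \<noteq> w" for v w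
    using that sep unfolding P_def dist_real_def by fastforce
  moreover have "bounded (Y \<inter> cball (a * z 0) (3 * \<rho> ^ m))" by (simp add: bounded_Int)
  ultimately have "card P \<le> covering_number r (Y \<inter> cball (a * z 0) (3 * \<rho> ^ m))"
    using r by (intro card_separated_le_covering_number) auto
  moreover have "a * z 0 \<in> Y" using Y[of 0] by (simp add: z_def)
  ultimately show ?thesis using \<open>card P = 2 ^ l\<close> by auto
qed

section \<open>The Assouad spectrum of a union of sheared pieces\<close>

text \<open>The infimum is attained at \<open>s\<close>: \<open>loc\<close> yields the covers for
  the upper bound, and \<open>approx\<close> yields nearly unsheared pieces with long index ranges,
  hence many separated points, for the lower bound.\<close>

lemma assouad_spectrum_cantor_pieces:
  fixes Y :: "real set" and s a \<theta> :: real
  defines "\<rho> \<equiv> cantor_ratio s"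
  assumes s: "0 < s" "s \<le> 1" and a: "1/2 \<le> \<bar>a\<bar>" "\<bar>a\<bar> \<le> 1" and \<theta>: "0 < \<theta>" "\<theta> < 1"
    and loc: "\<And>x. x \<in> Y \<Longrightarrow> \<exists>p \<tau>. Y \<inter> cball x 1 \<subseteq> range (\<lambda>i. a * (p + cantor_point \<rho> i + \<tau> * 4 ^ i))"
    and approx: "\<And>N \<epsilon>. 0 < \<epsilon> \<Longrightarrow>
      \<exists>p \<tau>. \<bar>\<tau>\<bar> < \<epsilon> \<and> (\<forall>i\<le>N. a * (p + cantor_point \<rho> i + \<tau> * 4 ^ i) \<in> Y)"
  shows "assouad_spectrum \<theta> Y = s"
  unfolding assouad_spectrum_def
proof (rule cInf_eq_minimum)
  define e where "e = 1 / \<theta> - 1"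
  have e: "0 < e" "1 / \<theta> = 1 + e" using \<theta> by (auto simp: e_def)
  have ratio: "R / R powr (1 / \<theta>) = R powr (- e)" if "0 < R" for R
    using that unfolding e(2) by (simp add: powr_add powr_minus divide_simps)
  \<comment> \<open>The additive 2 in the covering bound turns 312 into 314; the other terms absorb
    the logarithm.\<close>
  define C where "C = 314 + (1 / e + 1) / s + ln 8"
  have "0 < C" using e s by (simp add: C_def add_pos_nonneg)
  moreover have "covering_number (R powr (1 / \<theta>)) (Y \<inter> cball x R) \<le> C * (R / R powr (1 / \<theta>)) powr s"
    if "0 < R" "R < 1" "x \<in> Y" for R x
  proof -
    define r where "r = R powr (1 / \<theta>)"
    define w where "w = R / r"
    have w: "w = R powr (- e)" using ratio that by (simp add: w_def r_def)
    have "0 < r" using that by (simp add: r_def)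
    have "w \<ge> 1" using powr_mono'[of "- e" 0 R] that e by (simp add: w)
    then have "r \<le> R" using \<open>0 < r\<close> by (simp add: w_def)
    have "w powr s \<ge> 1" using \<open>w \<ge> 1\<close> s by (simp add: ge_one_powr_ge_zero)
    \<comment> \<open>As \<open>w\<close> is a negative power of \<open>R\<close>, this is
      \<open>ln 8\<close> plus a multiple of \<open>ln w\<close>, hence at most a multiple of
      \<open>w powr s\<close>. The factor \<open>1 / e\<close> is finite because
      \<open>\<theta> < 1\<close>.\<close>
    have "ln (8 / r) = ln 8 - (1 + e) * ln R"
      using that \<open>0 < r\<close> by (simp add: ln_div r_def ln_powr e(2))
    also have "(1 + e) * ln R = - (1 / e + 1) * ln w"
      using e that by (simp add: w ln_powr field_simps)
    also have "ln 8 - - (1 / e + 1) * ln w = ln 8 * 1 + (1 / e + 1) * ln w" by (simp add: algebra_simps)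
    also have "\<dots> \<le> ln 8 * w powr s + (1 / e + 1) * (w powr s / s)"
      using \<open>w powr s \<ge> 1\<close> e ln_powr_bound[OF \<open>w \<ge> 1\<close> s(1)] by (intro add_mono mult_left_mono) auto
    finally have "ln (8 / r) \<le> (ln 8 + (1 / e + 1) / s) * w powr s" by (simp add: algebra_simps)
    moreover obtain p \<tau> where "Y \<inter> cball x 1 \<subseteq> range (\<lambda>i. a * (p + cantor_point \<rho> i + \<tau> * 4 ^ i))"
      using loc[OF \<open>x \<in> Y\<close>] by blast
    then have "covering_number r (Y \<inter> cball x R) \<le> 312 * w powr s + 2 + ln (8 / r)"
      unfolding w_def \<rho>_def using s a \<open>0 < r\<close> \<open>r \<le> R\<close> \<open>R < 1\<close>
      by (intro covering_number_cantor_piece_le) auto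
    ultimately have "covering_number r (Y \<inter> cball x R) \<le> 314 * w powr s + (ln 8 + (1 / e + 1) / s) * w powr s"
      using \<open>w powr s \<ge> 1\<close> by linarith
    then show ?thesis unfolding r_def[symmetric] w_def[symmetric] C_def by (simp add: algebra_simps)
  qed
  ultimately show "s \<in> {\<alpha>. 0 \<le> \<alpha> \<and> (\<exists>C>0. \<forall>R. 0 < R \<and> R < 1 \<longrightarrow> (\<forall>x\<in>Y.
      real (covering_number (R powr (1 / \<theta>)) (Y \<inter> cball x R)) \<le> C * (R / R powr (1 / \<theta>)) powr \<alpha>))}"
    using s by auto
next
  define e where "e = 1 / \<theta> - 1"
  have e: "0 < e" "1 / \<theta> = 1 + e" using \<theta> by (auto simp: e_def)
  have ratio: "R / R powr (1 / \<theta>) = R powr (- e)" if "0 < R" for R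
    using that unfolding e(2) by (simp add: powr_add powr_minus divide_simps)
  fix \<alpha> assume "\<alpha> \<in> {\<alpha>. 0 \<le> \<alpha> \<and> (\<exists>C>0. \<forall>R. 0 < R \<and> R < 1 \<longrightarrow> (\<forall>x\<in>Y.
      real (covering_number (R powr (1 / \<theta>)) (Y \<inter> cball x R)) \<le> C * (R / R powr (1 / \<theta>)) powr \<alpha>))}"
  then obtain C where "0 \<le> \<alpha>" "0 < C" and C: "\<And>R x. 0 < R \<Longrightarrow> R < 1 \<Longrightarrow> x \<in> Y \<Longrightarrow>
      covering_number (R powr (1 / \<theta>)) (Y \<inter> cball x R) \<le> C * (R / R powr (1 / \<theta>)) powr \<alpha>"
    by blast
  show "s \<le> \<alpha>"
  proof (rule ccontr)
    assume "\<not> s \<le> \<alpha>"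
    then have "\<alpha> < s" by simp
    have \<rho>: "0 < \<rho>" "\<rho> \<le> 1/2" "\<rho> < 1"
      using cantor_ratio_pos[of s] cantor_ratio_le_half[OF s] by (auto simp: \<rho>_def)
    \<comment> \<open>The bound 27 makes \<open>27 / w < 1\<close>, so that a level \<open>l\<close>
      exists below; the other bound makes \<open>w powr (s - \<alpha>)\<close> exceed
      \<open>54 * C\<close>.\<close>
    define W where "W = max 27 ((54 * C) powr (1 / (s - \<alpha>)))"
    have "27 \<le> W" "(54 * C) powr (1 / (s - \<alpha>)) \<le> W" by (auto simp: W_def)
    \<comment> \<open>\<open>m\<close> is so large that \<open>R = 3 * \<rho> ^ m\<close> is below 1
      and \<open>w = R / r\<close> exceeds \<open>W\<close>.\<close>
    obtain m where m: "\<rho> ^ m < min 1 (W powr (- 1 / e)) / 3"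
      using real_arch_pow_inv[of "min 1 (W powr (- 1 / e)) / 3" \<rho>] \<rho> \<open>27 \<le> W\<close> by auto
    define R where "R = 3 * \<rho> ^ m"
    define r where "r = R powr (1 / \<theta>)"
    define w where "w = R / r"
    have R: "0 < R" "R < 1" "R < W powr (- 1 / e)" using m \<rho> by (auto simp: R_def)
    have w: "w = R powr (- e)" using ratio R by (simp add: w_def r_def)
    have "(W powr (- 1 / e)) powr (- e) < w"
      unfolding w using R e by (intro powr_less_mono2_neg) auto
    then have "W < w" using e \<open>27 \<le> W\<close> by (simp add: powr_powr)
    have "0 < r" using R by (simp add: r_def)
    have x: "9 * r / \<rho> ^ m = 27 / w" using \<open>0 < r\<close> \<rho> by (simp add: w_def R_def)
    \<comment> \<open>Since \<open>27 / w = 9 * r / \<rho> ^ m\<close>, the second inequality gives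
      \<open>9 * r \<le> \<rho> ^ (m + l)\<close>, with room for strictness at 8. The first bounds
      \<open>2 ^ l\<close> below by a multiple of \<open>w powr s\<close>.\<close>
    obtain l where l: "\<rho> ^ Suc l < 27 / w" "27 / w \<le> \<rho> ^ l"
      using power_interval[of \<rho> "27 / w"] \<rho> \<open>W < w\<close> \<open>27 \<le> W\<close> by auto
    have "9 * r \<le> \<rho> ^ (m + l)" using l(2) \<rho> unfolding x[symmetric] by (simp add: power_add field_simps)
    then have "8 * r < \<rho> ^ (m + l)" using \<open>0 < r\<close> by linarith
    then obtain x where "x \<in> Y" "2 ^ l \<le> covering_number r (Y \<inter> cball x R)"
      using covering_number_cantor_piece_ge[OF s a \<open>0 < r\<close>, of m l Y] approx
      unfolding R_def \<rho>_def by blast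
    then have "2 ^ l \<le> C * w powr \<alpha>"
      using C[OF R(1,2) \<open>x \<in> Y\<close>] unfolding w_def r_def
      by (metis of_nat_le_iff of_nat_numeral of_nat_power order_trans)
    have "w powr s / 27 powr 1 \<le> w powr s / 27 powr s"
      using s by (intro divide_left_mono powr_mono) auto
    also have "\<dots> = 1 / (27 / w) powr s" using \<open>W < w\<close> \<open>27 \<le> W\<close> by (simp add: powr_divide)
    also have "\<dots> \<le> 1 / (\<rho> ^ Suc l) powr s"
      using l(1) \<rho> s \<open>W < w\<close> \<open>27 \<le> W\<close> by (intro divide_left_mono powr_mono2) auto
    also have "\<dots> = 2 * 2 ^ l" unfolding \<rho>_def cantor_ratio_power_powr[OF s(1)] by simp
    finally have "w powr s \<le> 54 * C * w powr \<alpha>" using \<open>2 ^ l \<le> C * w powr \<alpha>\<close> by simp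
    then have "w powr (s - \<alpha>) \<le> 54 * C"
      using \<open>W < w\<close> \<open>27 \<le> W\<close> by (simp add: powr_diff field_simps)
    have "54 * C = ((54 * C) powr (1 / (s - \<alpha>))) powr (s - \<alpha>)"
      using \<open>\<alpha> < s\<close> \<open>0 < C\<close> by (simp add: powr_powr)
    also have "\<dots> < w powr (s - \<alpha>)"
      using \<open>\<alpha> < s\<close> \<open>W < w\<close> \<open>(54 * C) powr (1 / (s - \<alpha>)) \<le> W\<close> by (intro powr_less_mono2) auto
    finally show False using \<open>w powr (s - \<alpha>) \<le> 54 * C\<close> by simp
  qed
qed

section \<open>Projections in coordinates and the planar set\<close>

lemma proj_on_line_eq_image:
  assumes "V \<in> Gr21"
  shows "proj_on_line V X = (\<lambda>x. line_dir V $ 1 * x $ 1 + line_dir V $ 2 * x $ 2) ` X"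
proof -
  have "line_coord V (orth_proj V x) = line_dir V $ 1 * x $ 1 + line_dir V $ 2 * x $ 2" for x
  proof -
    have "line_coord V (orth_proj V x) = x \<bullet> line_dir V"
      using line_dir(2)[OF assms] unfolding line_coord_def orth_proj_eq[OF assms] by (simp add: norm_eq_1)
    also have "\<dots> = line_dir V $ 1 * x $ 1 + line_dir V $ 2 * x $ 2"
      by (simp add: inner_vec_def sum_2 mult.commute)
    finally show ?thesis .
  qed
  then show ?thesis unfolding proj_on_line_def image_image by simp
qed

text \<open>
  Piece \<open>j\<close> consists of the points \<open>i \<le> j\<close> around \<open>(M, M)\<close> with \<open>M = 100 * 4 ^ j\<close>. One of its coordinates
  (the first for \<open>j \<in> E\<close>, the second otherwise) carries the digit sum, sheared by \<open>q j\<close>, the other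
  one the lacunary height \<open>4 ^ i\<close>.
\<close>

locale lacunary_pieces =
  fixes c d q :: "nat \<Rightarrow> real" and E :: "nat set"
  assumes c_bounds: "0 \<le> c i" "c i \<le> 2" and d_bounds: "0 \<le> d i" "d i \<le> 2" and q_bound: "\<bar>q j\<bar> \<le> 1/4"
begin

definition fst_coord :: "nat \<Rightarrow> nat \<Rightarrow> real" where
  "fst_coord j i = 100 * 4 ^ j + (if j \<in> E then c i - q j * 4 ^ i else 4 ^ i)"

definition snd_coord :: "nat \<Rightarrow> nat \<Rightarrow> real" where
  "snd_coord j i = 100 * 4 ^ j + (if j \<in> E then 4 ^ i else d i - q j * 4 ^ i)"

text \<open>The projection onto a line whose direction has component ratio \<open>u\<close>, up to
  the scalar factor \<open>line_dir V $ 1\<close>.\<close>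

definition slope_coord :: "real \<Rightarrow> nat \<Rightarrow> nat \<Rightarrow> real" where
  "slope_coord u j i = fst_coord j i + u * snd_coord j i"

lemma slope_coord_fine:
  "j \<in> E \<Longrightarrow> slope_coord u j i = 100 * 4 ^ j * (1 + u) + c i + (u - q j) * 4 ^ i"
  by (simp add: slope_coord_def fst_coord_def snd_coord_def algebra_simps)

lemma slope_coord_coarse:
  "j \<notin> E \<Longrightarrow> slope_coord u j i = 100 * 4 ^ j * (1 + u) + u * d i + (1 - u * q j) * 4 ^ i"
  by (simp add: slope_coord_def fst_coord_def snd_coord_def algebra_simps)

lemma abs_mult_q_le:
  assumes "\<bar>u\<bar> \<le> 1/4"
  shows "\<bar>u * q j\<bar> \<le> 1/16"
  using mult_mono[OF assms q_bound[of j]] by (simp add: abs_mult)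

lemma abs_mult_d_le:
  assumes "\<bar>u\<bar> \<le> 1/4"
  shows "\<bar>u * d i\<bar> \<le> 1/2"
  using mult_mono[OF assms, of "d i" 2] d_bounds[of i] by (simp add: abs_mult)

text \<open>Confines piece \<open>j\<close> to an interval that is short compared with the distances
  between the centres of the pieces.\<close>

lemma slope_coord_near:
  assumes u: "\<bar>u\<bar> \<le> 1/4" and "i \<le> j"
  shows "\<bar>slope_coord u j i - 100 * 4 ^ j * (1 + u)\<bar> \<le> 4 * 4 ^ j"
proof -
  have pow: "(4::real) ^ i \<le> 4 ^ j" "(1::real) \<le> 4 ^ j" using assms by (auto intro: power_increasing)
  show ?thesis
  proof (cases "j \<in> E")
    case True
    have "\<bar>u - q j\<bar> * 4 ^ i \<le> 1/2 * 4 ^ j"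
    proof (rule mult_mono)
      show "\<bar>u - q j\<bar> \<le> 1/2" using u q_bound[of j] by linarith
    qed (use pow in auto)
    then have "\<bar>(u - q j) * 4 ^ i\<bar> \<le> 1/2 * 4 ^ j" by (simp add: abs_mult)
    then show ?thesis using True c_bounds[of i] pow unfolding slope_coord_fine[OF True] by linarith
  next
    case False
    have "\<bar>1 - u * q j\<bar> * 4 ^ i \<le> 2 * 4 ^ j"
    proof (rule mult_mono)
      show "\<bar>1 - u * q j\<bar> \<le> 2" using abs_mult_q_le[OF u, of j] by linarith
    qed (use pow in auto)
    then have "\<bar>(1 - u * q j) * 4 ^ i\<bar> \<le> 2 * 4 ^ j" by (simp add: abs_mult)
    then show ?thesis using abs_mult_d_le[OF u, of i] pow unfolding slope_coord_coarse[OF False] by linarith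
  qed
qed

text \<open>Different pieces are far apart, and in a coarse piece the heights \<open>4 ^ i\<close>
  outweigh the digit sums. The tolerance 2 is a unit window divided by a factor \<open>a\<close>
  with \<open>1/2 \<le> \<bar>a\<bar>\<close>.\<close>

lemma slope_coord_close:
  assumes u: "\<bar>u\<bar> \<le> 1/4" and "i \<le> j" "i' \<le> j'"
    and close: "\<bar>slope_coord u j i - slope_coord u j' i'\<bar> \<le> 2"
  shows "j = j' \<and> (j \<notin> E \<longrightarrow> i = i')"
proof -
  have aux: False if "j1 < j2" "i1 \<le> j1" "i2 \<le> j2" "\<bar>slope_coord u j1 i1 - slope_coord u j2 i2\<bar> \<le> 2" for j1 j2 i1 i2
  proof -
    have pow: "(4::real) ^ j2 \<ge> 4 * 4 ^ j1" "(1::real) \<le> 4 ^ j1" using power4_separated that by auto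
    define P where "P k = 100 * 4 ^ k * (1 + u)" for k :: nat
    \<comment> \<open>As \<open>3/4 \<le> 1 + u\<close>, the centres differ by at least
      \<open>75 * (4 ^ j2 - 4 ^ j1)\<close>, more than both radii and the tolerance
      together.\<close>
    have "3/4 * (4 ^ j2 - 4 ^ j1) \<le> (1 + u) * (4 ^ j2 - 4 ^ j1)"
    proof (rule mult_right_mono)
      show "0 \<le> (4::real) ^ j2 - 4 ^ j1" using pow by linarith
    qed (use u in auto)
    moreover have "P j2 - P j1 = 100 * ((1 + u) * (4 ^ j2 - 4 ^ j1))"
      by (simp add: P_def algebra_simps)
    ultimately have "75 * (4 ^ j2 - 4 ^ j1) \<le> P j2 - P j1" by simp
    moreover have "P j2 - P j1 \<le> 4 * 4 ^ j1 + 4 * 4 ^ j2 + 2"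
      using slope_coord_near[OF u that(2), folded P_def] slope_coord_near[OF u that(3), folded P_def]
        that(4) by linarith
    ultimately show False using pow by (simp add: right_diff_distrib)
  qed
  have "j = j'"
    using aux[of j j' i i'] aux[of j' j i' i] assms by (simp add: abs_minus_commute) (metis nat_neq_iff)
  moreover have "i = i'" if "j \<notin> E"
  proof -
    have aux2: False if "k < l" "\<bar>slope_coord u j k - slope_coord u j l\<bar> \<le> 2" for k l
    proof -
      \<comment> \<open>The heights contribute at least 45/16, which exceeds the tolerance 2 plus
        the digit part 1/2.\<close>
      have "15/16 * 3 \<le> (1 - u * q j) * (4 ^ l - 4 ^ k)"
      proof (rule mult_mono)
        show "15/16 \<le> 1 - u * q j" using abs_mult_q_le[OF u, of j] by linarith
        show "3 \<le> (4::real) ^ l - 4 ^ k" using that(1) by (rule power4_separated)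
      qed (use abs_mult_q_le[OF u, of j] in auto)
      moreover have "\<bar>u * d k - u * d l\<bar> \<le> 1/2"
        using mult_mono[OF u, of "\<bar>d k - d l\<bar>" 2] d_bounds[of k] d_bounds[of l]
        by (simp add: abs_mult flip: right_diff_distrib)
      ultimately show False
        using that(2) unfolding slope_coord_coarse[OF \<open>j \<notin> E\<close>] right_diff_distrib by linarith
    qed
    show ?thesis
      using aux2[of i i'] aux2[of i' i] close \<open>j = j'\<close> by (simp add: abs_minus_commute) (metis nat_neq_iff)
  qed
  ultimately show ?thesis by blast
qed

text \<open>A unit window meets only one piece: a sheared copy with shear \<open>u - q j\<close>, or
  a single point. Density of \<open>q\<close> makes the shear arbitrarily small for arbitrarily
  large \<open>j\<close>, and \<open>i \<le> j\<close> then gives long index ranges.\<close>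

lemma assouad_spectrum_slope:
  assumes s: "0 < s" "s \<le> 1" and c: "c = cantor_point (cantor_ratio s)"
    and a: "1/2 \<le> \<bar>a\<bar>" "\<bar>a\<bar> \<le> 1" and \<theta>: "0 < \<theta>" "\<theta> < 1" and u: "\<bar>u\<bar> \<le> 1/4"
    and dense: "\<And>N \<epsilon>. 0 < \<epsilon> \<Longrightarrow> \<exists>j\<ge>N. j \<in> E \<and> \<bar>u - q j\<bar> < \<epsilon>"
  shows "assouad_spectrum \<theta> {a * slope_coord u j i | j i. i \<le> j} = s" (is "assouad_spectrum \<theta> ?Y = s")
proof (rule assouad_spectrum_cantor_pieces[OF s a \<theta>])
  fix N :: nat and \<epsilon> :: real assume "0 < \<epsilon>"
  then obtain j where j: "j \<ge> N" "j \<in> E" "\<bar>u - q j\<bar> < \<epsilon>" using dense by blast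
  have "a * (100 * 4 ^ j * (1 + u) + c i + (u - q j) * 4 ^ i) \<in> ?Y" if "i \<le> N" for i
    using slope_coord_fine[OF j(2), of u i] that j(1) by (metis (mono_tags, lifting) le_trans mem_Collect_eq)
  then show "\<exists>p \<tau>. \<bar>\<tau>\<bar> < \<epsilon> \<and> (\<forall>i\<le>N. a * (p + cantor_point (cantor_ratio s) i + \<tau> * 4 ^ i) \<in> ?Y)"
    using j(3) unfolding c by blast
next
  fix x assume "x \<in> ?Y"
  then obtain j i where ji: "x = a * slope_coord u j i" "i \<le> j" by blast
  have same: "j' = j \<and> (j \<notin> E \<longrightarrow> i' = i)" if "i' \<le> j'" "a * slope_coord u j' i' \<in> cball x 1" for j' i'
  proof -
    have "\<bar>a\<bar> * \<bar>slope_coord u j i - slope_coord u j' i'\<bar> \<le> 1"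
      using that(2) by (simp add: ji(1) dist_real_def flip: abs_mult right_diff_distrib)
    moreover have "1/2 * \<bar>slope_coord u j i - slope_coord u j' i'\<bar> \<le> \<bar>a\<bar> * \<bar>slope_coord u j i - slope_coord u j' i'\<bar>"
      using a by (intro mult_right_mono) auto
    ultimately show ?thesis using slope_coord_close[OF u ji(2) that(1)] by auto
  qed
  show "\<exists>p \<tau>. ?Y \<inter> cball x 1 \<subseteq> range (\<lambda>i. a * (p + cantor_point (cantor_ratio s) i + \<tau> * 4 ^ i))"
  proof (cases "j \<in> E")
    case True
    have "?Y \<inter> cball x 1 \<subseteq> range (\<lambda>i. a * (100 * 4 ^ j * (1 + u) + c i + (u - q j) * 4 ^ i))"
    proof
      fix v assume v: "v \<in> ?Y \<inter> cball x 1"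
      then obtain j' i' where v': "v = a * slope_coord u j' i'" "i' \<le> j'" by blast
      then have "j' = j" using same v by blast
      then have "v = a * (100 * 4 ^ j * (1 + u) + c i' + (u - q j) * 4 ^ i')"
        using v'(1) slope_coord_fine[OF True, of u i'] by simp
      then show "v \<in> range (\<lambda>i. a * (100 * 4 ^ j * (1 + u) + c i + (u - q j) * 4 ^ i))"
        by (rule range_eqI)
    qed
    then show ?thesis unfolding c by (intro exI[of _ "100 * 4 ^ j * (1 + u)"] exI[of _ "u - q j"])
  next
    case False
    have "?Y \<inter> cball x 1 \<subseteq> {x}"
    proof
      fix v assume v: "v \<in> ?Y \<inter> cball x 1"
      then obtain j' i' where v': "v = a * slope_coord u j' i'" "i' \<le> j'" by blast
      then have "j' = j \<and> i' = i" using same v False by blast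
      then show "v \<in> {x}" using v'(1) ji(1) by simp
    qed
    \<comment> \<open>A single point has the required form with index 0 and zero shear.\<close>
    moreover have "x = a * (slope_coord u j i + cantor_point (cantor_ratio s) 0 + 0 * 4 ^ 0)"
      by (simp add: ji(1))
    then have "x \<in> range (\<lambda>k. a * (slope_coord u j i + cantor_point (cantor_ratio s) k + 0 * 4 ^ k))"
      by (rule range_eqI)
    ultimately show ?thesis
      by (intro exI[of _ "slope_coord u j i"] exI[of _ 0]) auto
  qed
qed

lemma quasi_assouad_dim_slope:
  assumes "0 < s" "s \<le> 1" "c = cantor_point (cantor_ratio s)" "1/2 \<le> \<bar>a\<bar>" "\<bar>a\<bar> \<le> 1" "\<bar>u\<bar> \<le> 1/4"
    and "\<And>N \<epsilon>. 0 < \<epsilon> \<Longrightarrow> \<exists>j\<ge>N. j \<in> E \<and> \<bar>u - q j\<bar> < \<epsilon>"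
  shows "quasi_assouad_dim {a * slope_coord u j i | j i. i \<le> j} = s"
  unfolding quasi_assouad_dim_def
proof (rule tendsto_Lim)
  have "eventually (\<lambda>\<theta>::real. \<theta> \<in> {0<..<1}) (at_left 1)"
    by (rule eventually_at_leftI[of 0]) auto
  then have "eventually (\<lambda>\<theta>. assouad_spectrum \<theta> {a * slope_coord u j i | j i. i \<le> j} = s) (at_left 1)"
    by eventually_elim (use assouad_spectrum_slope[OF assms(1-5) _ _ assms(6,7)] in auto)
  then show "((\<lambda>\<theta>. assouad_spectrum \<theta> {a * slope_coord u j i | j i. i \<le> j}) \<longlongrightarrow> s) (at_left 1)"
    by (rule tendsto_eventually)
qed simp

definition plane_set :: "(real^2) set" where
  "plane_set = {vector [fst_coord j i, snd_coord j i] | j i. i \<le> j}"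

lemma unbounded_plane_set: "\<not> bounded plane_set"
proof
  assume "bounded plane_set"
  then obtain B where B: "\<And>x. x \<in> plane_set \<Longrightarrow> norm x \<le> B" by (auto simp: bounded_iff)
  obtain j :: nat where j: "B < j" using reals_Archimedean2 by blast
  have "real j < 4 ^ j"
    by (rule order_less_le_trans[OF of_nat_less_two_power power_mono]) auto
  moreover have "4 ^ j \<le> fst_coord j 0"
  proof -
    have "(1::real) \<le> 4 ^ j" by simp
    moreover have "fst_coord j 0 = 100 * 4 ^ j + (if j \<in> E then c 0 - q j else 1)"
      by (simp add: fst_coord_def)
    ultimately show ?thesis using q_bound[of j] c_bounds[of 0] by (cases "j \<in> E"; simp only: if_True if_False; linarith)
  qed
  moreover have "fst_coord j 0 \<le> norm (vector [fst_coord j 0, snd_coord j 0] :: real^2)"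
    using component_le_norm_cart[of "vector [fst_coord j 0, snd_coord j 0] :: real^2" 1] by simp
  moreover have "vector [fst_coord j 0, snd_coord j 0] \<in> plane_set" unfolding plane_set_def by blast
  note B[OF this]
  ultimately show False using j by linarith
qed

text \<open>The first coordinate is \<open>slope_coord\<close> at \<open>u = 0\<close>, so it
  determines the piece, and also the point if the piece is coarse. In a fine piece the heights in
  the second coordinate are at least 3 apart.\<close>

lemma uniform_discrete_plane_set: "uniform_discrete plane_set"
  unfolding uniform_discrete_def
proof (intro exI[of _ "1::real"] conjI ballI impI)
  fix x y assume "x \<in> plane_set" "y \<in> plane_set" and xy: "dist x y < 1"
  then obtain j i j' i' where eq: "x = vector [fst_coord j i, snd_coord j i]" "i \<le> j"
    "y = vector [fst_coord j' i', snd_coord j' i']" "i' \<le> j'"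
    unfolding plane_set_def by blast
  have "\<bar>fst_coord j i - fst_coord j' i'\<bar> < 1" "\<bar>snd_coord j i - snd_coord j' i'\<bar> < 1"
    using order_le_less_trans[OF dist_vec_nth_le[of x 1 y] xy]
      order_le_less_trans[OF dist_vec_nth_le[of x 2 y] xy]
    by (simp_all add: eq(1,3) dist_real_def)
  then have close: "j = j'" "j \<notin> E \<Longrightarrow> i = i'" "\<bar>snd_coord j i - snd_coord j' i'\<bar> < 1"
    using slope_coord_close[of 0 i j i' j'] eq by (auto simp: slope_coord_def)
  moreover have "i = i'" if "j \<in> E"
  proof (rule ccontr)
    assume "i \<noteq> i'"
    then have "i < i' \<or> i' < i" by auto
    then show False
      using close that power4_separated(2)[of i i'] power4_separated(2)[of i' i]
      by (auto simp: snd_coord_def)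
  qed
  ultimately show "x = y" using eq by blast
qed simp

lemma proj_on_line_plane_set_fst:
  assumes "V \<in> Gr21" "line_dir V $ 1 \<noteq> 0"
  shows "proj_on_line V plane_set =
    {line_dir V $ 1 * (fst_coord j i + line_dir V $ 2 / line_dir V $ 1 * snd_coord j i) | j i. i \<le> j}"
proof -
  have "line_dir V $ 1 * fst_coord j i + line_dir V $ 2 * snd_coord j i =
    line_dir V $ 1 * (fst_coord j i + line_dir V $ 2 / line_dir V $ 1 * snd_coord j i)" for j i
    using assms(2) by (simp add: field_simps)
  moreover have "proj_on_line V plane_set =
    {line_dir V $ 1 * (vector [fst_coord j i, snd_coord j i] :: real^2) $ 1 +
      line_dir V $ 2 * (vector [fst_coord j i, snd_coord j i] :: real^2) $ 2 | j i. i \<le> j}"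
    unfolding proj_on_line_eq_image[OF assms(1)] plane_set_def by blast
  ultimately show ?thesis by (simp only: vector_2)
qed

lemma proj_on_line_plane_set_snd:
  assumes "V \<in> Gr21" "line_dir V $ 2 \<noteq> 0"
  shows "proj_on_line V plane_set =
    {line_dir V $ 2 * (snd_coord j i + line_dir V $ 1 / line_dir V $ 2 * fst_coord j i) | j i. i \<le> j}"
proof -
  have "line_dir V $ 1 * fst_coord j i + line_dir V $ 2 * snd_coord j i =
    line_dir V $ 2 * (snd_coord j i + line_dir V $ 1 / line_dir V $ 2 * fst_coord j i)" for j i
    using assms(2) by (simp add: field_simps)
  moreover have "proj_on_line V plane_set =
    {line_dir V $ 1 * (vector [fst_coord j i, snd_coord j i] :: real^2) $ 1 +
      line_dir V $ 2 * (vector [fst_coord j i, snd_coord j i] :: real^2) $ 2 | j i. i \<le> j}"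
    unfolding proj_on_line_eq_image[OF assms(1)] plane_set_def by blast
  ultimately show ?thesis by (simp only: vector_2)
qed

end

section \<open>Dense shears and cones of lines\<close>

text \<open>The rationals, clamped to the interval, are indexed through pairs whose second entry is
  ignored, so each recurs beyond every \<open>N\<close>. Using \<open>j div 2\<close> gives the same
  values at even and odd places.\<close>

lemma exists_dense_sequence:
  obtains q :: "nat \<Rightarrow> real" where "\<And>j. \<bar>q j\<bar> \<le> 1/4"
    "\<And>u \<epsilon> N. \<bar>u\<bar> \<le> 1/4 \<Longrightarrow> 0 < \<epsilon> \<Longrightarrow> \<exists>j\<ge>N. even j \<and> \<bar>u - q j\<bar> < \<epsilon>"
    "\<And>u \<epsilon> N. \<bar>u\<bar> \<le> 1/4 \<Longrightarrow> 0 < \<epsilon> \<Longrightarrow> \<exists>j\<ge>N. odd j \<and> \<bar>u - q j\<bar> < \<epsilon>"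
proof -
  define q :: "nat \<Rightarrow> real" where
    "q j = max (- 1/4) (min (1/4) (of_rat (nat_to_rat_surj (fst (prod_decode (j div 2))))))" for j
  have near: "\<exists>k\<ge>N. \<bar>u - q (2 * k)\<bar> < \<epsilon> \<and> \<bar>u - q (2 * k + 1)\<bar> < \<epsilon>" if "\<bar>u\<bar> \<le> 1/4" "0 < \<epsilon>" for u \<epsilon> N
  proof -
    obtain r where r: "u < of_rat r" "of_rat r < u + \<epsilon>" using of_rat_dense[of u "u + \<epsilon>"] \<open>0 < \<epsilon>\<close> by auto
    obtain n where n: "r = nat_to_rat_surj n" using surj_nat_to_rat_surj by (metis surjD)
    define k where "k = prod_encode (n, N)"
    have "q (2 * k) = max (- 1/4) (min (1/4) (of_rat r))" "q (2 * k + 1) = max (- 1/4) (min (1/4) (of_rat r))"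
      by (simp_all add: q_def k_def n)
    \<comment> \<open>Clamping to an interval that contains \<open>u\<close> does not increase the
      distance to \<open>u\<close>.\<close>
    then have "\<bar>u - q (2 * k)\<bar> < \<epsilon>" "\<bar>u - q (2 * k + 1)\<bar> < \<epsilon>" using r that by (auto simp: max_def min_def)
    moreover have "N \<le> k" unfolding k_def by (rule le_prod_encode_2)
    ultimately show ?thesis by blast
  qed
  show thesis
  proof (rule that)
    show "\<bar>q j\<bar> \<le> 1/4" for j unfolding q_def by linarith
    fix u \<epsilon> :: real and N assume "\<bar>u\<bar> \<le> 1/4" "0 < \<epsilon>"
    then obtain k where k: "k \<ge> N" "\<bar>u - q (2 * k)\<bar> < \<epsilon>" "\<bar>u - q (2 * k + 1)\<bar> < \<epsilon>" using near by blast
    show "\<exists>j\<ge>N. even j \<and> \<bar>u - q j\<bar> < \<epsilon>" using k by (intro exI[of _ "2 * k"]) auto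
    show "\<exists>j\<ge>N. odd j \<and> \<bar>u - q j\<bar> < \<epsilon>" using k by (intro exI[of _ "2 * k + 1"]) auto
  qed
qed

text \<open>The absolute value removes the dependence on the sign of the chosen direction. The bound
  49/50 keeps the slopes relative to the axis within 1/4, the range of the shears.\<close>

definition axis_cone :: "2 \<Rightarrow> (real^2) set set" where
  "axis_cone k = {V \<in> Gr21. 49/50 < \<bar>line_dir V $ k\<bar>}"

lemma span_axis_in_Gr21: "span {axis k (1::real)} \<in> Gr21"
proof -
  have "dim {axis k (1::real)} = 1"
    by (subst dim_singleton) (simp add: axis_eq_0_iff)
  then show ?thesis by (simp add: Gr21_def)
qed

text \<open>The component \<open>\<bar>line_dir V $ k\<bar>\<close> is the cosine of the angle to
  the axis, and \<open>arccos\<close> is decreasing.\<close>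

lemma axis_cone_eq_mball:
  "axis_cone k = Metric_space.mball Gr21 line_angle (span {axis k 1}) (arccos (49/50))"
proof -
  interpret Metric_space Gr21 line_angle by (rule Metric_space_Gr21)
  have "49/50 < \<bar>line_dir V $ k\<bar> \<longleftrightarrow> line_angle (span {axis k 1}) V < arccos (49/50)"
    if V: "V \<in> Gr21" for V
  proof -
    have "line_angle (span {axis k 1}) V = arccos \<bar>axis k 1 \<bullet> line_dir V\<bar>"
      using line_dir[OF V] by (intro line_angle_eq span_axis_in_Gr21 V) (auto simp: span_base)
    moreover have "\<bar>line_dir V $ k\<bar> \<le> 1"
      using component_le_norm_cart[of "line_dir V" k] line_dir(2)[OF V] by simp
    ultimately show ?thesis
      by (simp add: inner_axis' arccos_less_mono)
  qed
  then show ?thesis using span_axis_in_Gr21[of k] by (auto simp: axis_cone_def in_mball)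
qed

lemma openin_axis_cone: "openin Gr21_topology (axis_cone k)"
  unfolding axis_cone_eq_mball Gr21_topology_def
  by (rule Metric_space.openin_mball[OF Metric_space_Gr21])

lemma axis_cone_nonempty: "axis_cone k \<noteq> {}"
proof -
  have "0 < arccos (49/50)" using arccos_less_arccos[of "49/50" 1] by simp
  then have "span {axis k 1} \<in> axis_cone k"
    unfolding axis_cone_eq_mball using span_axis_in_Gr21
    by (simp add: Metric_space.in_mball[OF Metric_space_Gr21] Metric_space.mdist_zero[OF Metric_space_Gr21])
  then show ?thesis by blast
qed

lemma sum_squares_line_dir:
  assumes "V \<in> Gr21"
  shows "(line_dir V $ 1)\<^sup>2 + (line_dir V $ 2)\<^sup>2 = 1"
  using line_dir(2)[OF assms] by (simp add: norm_vec_def L2_set_def sum_2)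

text \<open>Since \<open>(49/50)\<^sup>2 > 1 - (1/5)\<^sup>2\<close>, the other component is below
  1/5. In particular the cones about the two axes are disjoint.\<close>

lemma abs_slope_le:
  fixes x y :: real
  assumes "x\<^sup>2 + y\<^sup>2 = 1" "49/50 < \<bar>x\<bar>"
  shows "\<bar>y / x\<bar> \<le> 1/4" "1/2 \<le> \<bar>x\<bar>" "\<bar>x\<bar> \<le> 1" "\<not> 49/50 < \<bar>y\<bar>" "x \<noteq> 0"
proof -
  have "(49/50)\<^sup>2 < \<bar>x\<bar>\<^sup>2" using assms(2) by (intro power_strict_mono) auto
  then have y: "y\<^sup>2 < (1/5)\<^sup>2" using assms(1) by (simp add: power2_eq_square)
  then have "\<bar>y\<bar> < 1/5" using abs_square_less_1 power2_less_imp_less[of "\<bar>y\<bar>" "1/5"] by simp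
  then show "\<bar>y / x\<bar> \<le> 1/4" "\<not> 49/50 < \<bar>y\<bar>" using assms(2) by (auto simp: abs_divide divide_le_eq)
  have "x\<^sup>2 \<le> 1" using assms(1) zero_le_power2[of y] by linarith
  then show "\<bar>x\<bar> \<le> 1" by (simp add: abs_square_le_1)
  show "1/2 \<le> \<bar>x\<bar>" "x \<noteq> 0" using assms(2) by auto
qed

section \<open>Assembly of the planar set and the two cones\<close>

theorem corollary2p10:
  fixes s t :: real
  assumes "0 < s" "s < t" "t \<le> 1"
  shows "\<exists>(X :: (real^2) set) I\<^sub>s I\<^sub>t.
    uniform_discrete X \<and> \<not> bounded X \<and>
    openin Gr21_topology I\<^sub>s \<and> openin Gr21_topology I\<^sub>t \<and>
    I\<^sub>s \<noteq> {} \<and> I\<^sub>t \<noteq> {} \<and> I\<^sub>s \<inter> I\<^sub>t = {} \<and>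
    (\<forall>V\<in>I\<^sub>s. quasi_assouad_dim (proj_on_line V X) = s) \<and>
    (\<forall>V\<in>I\<^sub>t. quasi_assouad_dim (proj_on_line V X) = t)"
proof -
  obtain q :: "nat \<Rightarrow> real" where q: "\<And>j. \<bar>q j\<bar> \<le> 1/4"
    "\<And>u \<epsilon> N. \<bar>u\<bar> \<le> 1/4 \<Longrightarrow> 0 < \<epsilon> \<Longrightarrow> \<exists>j\<ge>N. even j \<and> \<bar>u - q j\<bar> < \<epsilon>"
    "\<And>u \<epsilon> N. \<bar>u\<bar> \<le> 1/4 \<Longrightarrow> 0 < \<epsilon> \<Longrightarrow> \<exists>j\<ge>N. odd j \<and> \<bar>u - q j\<bar> < \<epsilon>"
    by (rule exists_dense_sequence) blast
  define c where "c \<sigma> = cantor_point (cantor_ratio \<sigma>)" for \<sigma>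
  have c: "0 \<le> c \<sigma> i" "c \<sigma> i \<le> 2" if "0 < \<sigma>" "\<sigma> \<le> 1" for \<sigma> i
    using cantor_ratio_pos[of \<sigma>] cantor_ratio_le_half[OF that]
    by (auto simp: c_def cantor_point_nonneg cantor_point_le_2)
  have st: "s \<le> 1" "0 < t" using assms by auto
  define E :: "nat set" where "E = {j. even j}"
  interpret S: lacunary_pieces "c s" "c t" q E
    using c assms st q(1) by unfold_locales auto
  \<comment> \<open>Exchanging the dimensions and complementing \<open>E\<close> describes the same
    set with its coordinates swapped, so the results for the first axis also apply to the
    second.\<close>
  interpret T: lacunary_pieces "c t" "c s" q "- E"
    using c assms st q(1) by unfold_locales auto
  have swap: "T.fst_coord j i = S.snd_coord j i" "T.snd_coord j i = S.fst_coord j i" for j i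
    by (simp_all add: T.fst_coord_def S.fst_coord_def T.snd_coord_def S.snd_coord_def)
  have "quasi_assouad_dim (proj_on_line V S.plane_set) = s" if "V \<in> axis_cone 1" for V
  proof -
    have V: "V \<in> Gr21" "49/50 < \<bar>line_dir V $ 1\<bar>" using that by (auto simp: axis_cone_def)
    note slope = abs_slope_le[OF sum_squares_line_dir[OF V(1)] V(2)]
    show ?thesis
      unfolding S.proj_on_line_plane_set_fst[OF V(1) slope(5)] S.slope_coord_def[symmetric]
      using q(2)[OF slope(1)]
      by (intro S.quasi_assouad_dim_slope assms st slope) (auto simp: c_def E_def)
  qed
  moreover have "quasi_assouad_dim (proj_on_line V S.plane_set) = t" if "V \<in> axis_cone 2" for V
  proof -
    have V: "V \<in> Gr21" "49/50 < \<bar>line_dir V $ 2\<bar>" using that by (auto simp: axis_cone_def)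
    have "(line_dir V $ 2)\<^sup>2 + (line_dir V $ 1)\<^sup>2 = 1" using sum_squares_line_dir[OF V(1)] by simp
    note slope = abs_slope_le[OF this V(2)]
    show ?thesis
      unfolding S.proj_on_line_plane_set_snd[OF V(1) slope(5)] swap[symmetric] T.slope_coord_def[symmetric]
      using q(3)[OF slope(1)]
      by (intro T.quasi_assouad_dim_slope assms st slope) (auto simp: c_def E_def)
  qed
  moreover have "axis_cone 1 \<inter> axis_cone 2 = {}"
    using abs_slope_le(4)[OF sum_squares_line_dir] by (auto simp: axis_cone_def)
  ultimately show ?thesis
    using S.uniform_discrete_plane_set S.unbounded_plane_set openin_axis_cone axis_cone_nonempty
    by (intro exI[of _ S.plane_set] exI[of _ "axis_cone 1"] exI[of _ "axis_cone 2"]) simp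
qed

end
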